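(* The performance bound $\gamma^*$, i.e. the optimal value of Problem (U$_T$) defined in the context, is monotonically nonincreasing with respect to the data length $T$: when a data trajectory of length $T$ is extended by one further data point to length $T+1$ (the earlier data being kept), the optimal value of Problem (U$_{T+1}$) is less than or equal to the optimal value of Problem (U$_T$).
   Context: $\mathbb{S}^{n}_{++}$ denotes the set of real symmetric positive definite $n\times n$ matrices; $\succ,\succeq$ denote the Loewner order. Fixed matrices: $C\in\mathbb{R}^{n_y\times n_x}$, $D\in\mathbb{R}^{n_y\times n_u}$, $G\in\mathbb{R}^{n_x\times n_d}$. Data: states $x_0,x_1,\ldots\in\mathbb{R}^{n_x}$ and inputs $u_0,u_1,\ldots\in\mathbb{R}^{n_u}$ are collected along a trajectory of $x_{k+1}=A_*x_k+B_*u_k+w_k$ with unknown matrices $A_*,B_*$ and unknown noise satisfying $\|w_k\|_2\le\epsilon$ for all $k$, where $\epsilon>0$ is known. Data of length $T$ (a positive integer) means $x_0,\ldots,x_T$ and $u_0,\ldots,u_{T-1}$. For each $i$ define the symmetric matrix of size $2n_x+n_u$ $$\Psi_i=\begin{bmatrix} I & x_{i+1}\\ 0&-x_i\\ 0&-u_i\end{bmatrix}\begin{bmatrix}\epsilon^2 I&0\\0&-1\end{bmatrix}\begin{bmatrix} I & x_{i+1}\\ 0&-x_i\\ 0&-u_i\end{bmatrix}^\top .$$ Problem (U$_T$) (data-driven unstructured $H_2$ design with data length $T$): minimize $\gamma$ over $P,L,Q,\{\alpha_i\}_{i=0,\ldots,T-1},\beta,\gamma$ (with $L\in\mathbb{R}^{n_u\times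 n_x}$, $\alpha_i,\beta$ real scalars, $\gamma\ge0$) subject to (a) $\begin{bmatrix} P-GG^\top-\beta I&0&0&0\\0&0&0&P\\0&0&0&L\\0&P&L^\top&P\end{bmatrix}-\begin{bmatrix}\sum_{i=0}^{T-1}\alpha_i\Psi_i&0\\0&0\end{bmatrix}\succeq0$, where the row/column blocks of the first matrix have sizes $n_x,n_x,n_u,n_x$ and the second matrix is partitioned with blocks of sizes $2n_x+n_u$ and $n_x$; (b) $\begin{bmatrix}Q&CP+DL\\(CP+DL)^\top&P\end{bmatrix}\succ0$, $\operatorname{Tr}(Q)\le\gamma^2$; (c) $\alpha_0\ge0,\ldots,\alpha_{T-1}\ge0$, $\beta>0$; (d) $P\in\mathbb{S}^{n_x}_{++}$, $Q\in\mathbb{S}^{n_y}_{++}$. The optimal value is the infimum of $\gamma$ over the feasible set, equal to $+\infty$ if the feasible set is empty. *)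

theory Defs
  imports "HOL-Analysis.Analysis"
begin

text \<open>
  Block matrices are indexed by sum types: a block row (column) of sizes
  \<open>CARD('a)\<close> and \<open>CARD('b)\<close> is indexed by \<open>'a + 'b\<close>.
\<close>

definition hcat :: "real^'c^'a \<Rightarrow> real^'d^'a \<Rightarrow> real^('c + 'd)^'a" where
  "hcat A B = (\<chi> i j. case j of Inl k \<Rightarrow> A $ i $ k | Inr k \<Rightarrow> B $ i $ k)"

definition vcat :: "real^'c^'a \<Rightarrow> real^'c^'b \<Rightarrow> real^'c^('a + 'b)" where
  "vcat A B = (\<chi> i. case i of Inl k \<Rightarrow> A $ k | Inr k \<Rightarrow> B $ k)"

definition block22 ::
  "real^'c^'a \<Rightarrow> real^'d^'a \<Rightarrow> real^'c^'b \<Rightarrow> real^'d^'b \<Rightarrow> real^('c + 'd)^('a + 'b)" where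
  "block22 A B C D = vcat (hcat A B) (hcat C D)"

definition pos_semidef :: "real^'n^'n \<Rightarrow> bool" where
  "pos_semidef M \<longleftrightarrow> transpose M = M \<and> (\<forall>v. 0 \<le> v \<bullet> (M *v v))"

definition pos_def :: "real^'n^'n \<Rightarrow> bool" where
  "pos_def M \<longleftrightarrow> transpose M = M \<and> (\<forall>v. v \<noteq> 0 \<longrightarrow> 0 < v \<bullet> (M *v v))"

definition noisy_trajectory ::
  "real^'nx^'nx \<Rightarrow> real^'nu^'nx \<Rightarrow> real \<Rightarrow> (nat \<Rightarrow> real^'nx) \<Rightarrow> (nat \<Rightarrow> real^'nu) \<Rightarrow>
   (nat \<Rightarrow> real^'nx) \<Rightarrow> bool" where
  "noisy_trajectory A B \<epsilon> x u w \<longleftrightarrow>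
     (\<forall>k. x (Suc k) = A *v x k + B *v u k + w k \<and> norm (w k) \<le> \<epsilon>)"

text \<open>The one-column blocks of the data factor are indexed by the singleton type \<open>1\<close>.\<close>

definition data_factor ::
  "(nat \<Rightarrow> real^'nx) \<Rightarrow> (nat \<Rightarrow> real^'nu) \<Rightarrow> nat \<Rightarrow> real^('nx + 1)^('nx + ('nx + 'nu))" where
  "data_factor x u i =
     vcat (hcat (mat 1) (columnvector (x (Suc i))))
    (vcat (hcat 0       (- columnvector (x i)))
          (hcat 0       (- columnvector (u i))))"

definition Psi ::
  "real \<Rightarrow> (nat \<Rightarrow> real^'nx) \<Rightarrow> (nat \<Rightarrow> real^'nu) \<Rightarrow> nat \<Rightarrow>
   real^('nx + ('nx + 'nu))^('nx + ('nx + 'nu))" where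
  "Psi \<epsilon> x u i =
     data_factor x u i ** block22 (mat (\<epsilon>\<^sup>2)) 0 0 (mat (-1)) ** transpose (data_factor x u i)"

text \<open>
  The two matrices in the data constraint. The 4-by-4 block matrix is grouped
  as \<open>('nx + ('nx + 'nu)) + 'nx\<close>, so that its partition agrees with that of the second one.
\<close>

definition lmi_design ::
  "real^'nd^'nx \<Rightarrow> real^'nx^'nx \<Rightarrow> real^'nx^'nu \<Rightarrow> real \<Rightarrow>
   real^(('nx + ('nx + 'nu)) + 'nx)^(('nx + ('nx + 'nu)) + 'nx)" where
  "lmi_design G P L \<beta> =
     block22 (block22 (P - G ** transpose G - mat \<beta>) 0 0 0)  (vcat 0 (vcat P L))
             (hcat 0 (hcat P (transpose L)))                 P"

definition lmi_data ::
  "real \<Rightarrow> (nat \<Rightarrow> real^'nx) \<Rightarrow> (nat \<Rightarrow> real^'nu) \<Rightarrow> nat \<Rightarrow> (nat \<Rightarrow> real) \<Rightarrow>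
   real^(('nx + ('nx + 'nu)) + 'nx)^(('nx + ('nx + 'nu)) + 'nx)" where
  "lmi_data \<epsilon> x u T \<alpha> = block22 (\<Sum>i<T. \<alpha> i *\<^sub>R Psi \<epsilon> x u i) 0 0 0"

text \<open>The multipliers are a function on \<open>nat\<close>; only its values below \<open>T\<close> matter.\<close>

definition feasible ::
  "real^'nx^'ny \<Rightarrow> real^'nu^'ny \<Rightarrow> real^'nd^'nx \<Rightarrow> real \<Rightarrow>
   (nat \<Rightarrow> real^'nx) \<Rightarrow> (nat \<Rightarrow> real^'nu) \<Rightarrow> nat \<Rightarrow>
   real^'nx^'nx \<Rightarrow> real^'nx^'nu \<Rightarrow> real^'ny^'ny \<Rightarrow> (nat \<Rightarrow> real) \<Rightarrow> real \<Rightarrow> real \<Rightarrow> bool" where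
  "feasible C D G \<epsilon> x u T P L Q \<alpha> \<beta> \<gamma> \<longleftrightarrow>
     pos_semidef (lmi_design G P L \<beta> - lmi_data \<epsilon> x u T \<alpha>) \<and>
     pos_def (block22 Q (C ** P + D ** L) (transpose (C ** P + D ** L)) P) \<and>
     trace Q \<le> \<gamma>\<^sup>2 \<and> 0 \<le> \<gamma> \<and>
     (\<forall>i<T. 0 \<le> \<alpha> i) \<and> 0 < \<beta> \<and>
     pos_def P \<and> pos_def Q"

text \<open>Infimum in the extended reals, hence \<open>\<infinity>\<close> if the problem is infeasible.\<close>

definition optimal_value ::
  "real^'nx^'ny \<Rightarrow> real^'nu^'ny \<Rightarrow> real^'nd^'nx \<Rightarrow> real \<Rightarrow>
   (nat \<Rightarrow> real^'nx) \<Rightarrow> (nat \<Rightarrow> real^'nu) \<Rightarrow> nat \<Rightarrow> ereal" where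
  "optimal_value C D G \<epsilon> x u T =
     (INF \<gamma> \<in> {\<gamma>. \<exists>P L Q \<alpha> \<beta>. feasible C D G \<epsilon> x u T P L Q \<alpha> \<beta> \<gamma>}. ereal \<gamma>)"

end

theory Submission
  imports Defs
begin

text \<open>
  A further data point enters the problem only through one additional multiplier. Giving it the
  value zero removes the new data matrix from the linear matrix inequality, so every feasible
  point for length \<open>T\<close> yields one for length \<open>T + 1\<close> with the same \<open>\<gamma>\<close>. The set of attainable
  bounds therefore grows with the data, and its infimum cannot increase. This reflects that the
  multipliers are a relaxation of the data constraints: ignoring a data point is always allowed.
\<close>

lemma lmi_data_Suc_zero_multiplier:
  "lmi_data \<epsilon> x u (Suc T) (\<alpha>(T := 0)) = lmi_data \<epsilon> x u T \<alpha>"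
  by (simp add: lmi_data_def)

lemma feasible_Suc_zero_multiplier:
  assumes "feasible C D G \<epsilon> x u T P L Q \<alpha> \<beta> \<gamma>"
  shows "feasible C D G \<epsilon> x u (Suc T) P L Q (\<alpha>(T := 0)) \<beta> \<gamma>"
  using assms by (simp add: feasible_def lmi_data_Suc_zero_multiplier less_Suc_eq)

lemma optimal_value_Suc_le:
  "optimal_value C D G \<epsilon> x u (Suc T) \<le> optimal_value C D G \<epsilon> x u T"
  unfolding optimal_value_def
  by (rule INF_superset_mono) (use feasible_Suc_zero_multiplier in blast)+

theorem theorem3:
  fixes C :: "real^'nx^'ny" and D :: "real^'nu^'ny" and G :: "real^'nd^'nx"
    and A :: "real^'nx^'nx" and B :: "real^'nu^'nx"
    and x :: "nat \<Rightarrow> real^'nx" and u :: "nat \<Rightarrow> real^'nu" and w :: "nat \<Rightarrow> real^'nx"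
    and \<epsilon> :: real
  assumes "\<epsilon> > 0"
    and "noisy_trajectory A B \<epsilon> x u w"
  shows "(\<forall>T\<ge>1. optimal_value C D G \<epsilon> x u (Suc T) \<le> optimal_value C D G \<epsilon> x u T) \<and>
         antimono_on {1..} (\<lambda>T. optimal_value C D G \<epsilon> x u T)"
  using lift_Suc_antimono_le[of "optimal_value C D G \<epsilon> x u"]
  by (auto intro!: monotone_onI simp: optimal_value_Suc_le)

end
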